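(* Let $\mathcal X\subset\mathbb R^n$ be Lebesgue measurable and let $g,h_1,\dots,h_k$ be real-valued functions that are $C^\infty$ on an open neighborhood of $\mathcal X\times\mathbb R^m$. Assume there is a constant $\rho>0$ such that for every $x\in\mathcal X$ there is a point $y$ in the interior of $\mathcal Y(x)=\{y\in\mathbb R^m: h_i(x,y)\le0,\ i=1,\dots,k\}$ with $h_i(x,y)\le-\rho$ for all $i=1,\dots,k$. Fix any constant $0<\nu<\rho$, draw $b=(b_1,\dots,b_m)$ uniformly from $[0,\nu]^m$ and $a=(a_1,\dots,a_k)$ uniformly from $[0,\nu]^k$, and set $$\widetilde g(x,y)=g(x,y)+\langle y,b\rangle,\qquad \widetilde h_i(x,y)=h_i(x,y)+a_i\quad\text{for all }i.$$ Then, with probability one with respect to the random choice of $(b,a)$, the set of $x\in\mathcal X$ at which the strict complementary slackness condition (SCSC) does not hold at some KKT point $y$ of the perturbed problem $\min_y\widetilde g(x,y)$ s.t. $\widetilde h_i(x,y)\le0$, $i=1,\dots,k$, has Lebesgue measure zero.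
   Context: KKT pair of the perturbed problem at $x$: $(y,\lambda)\in\mathbb R^m\times\mathbb R^k$ with $\nabla_y\widetilde g(x,y)+\sum_i\lambda_i\nabla_y\widetilde h_i(x,y)=0$, $\widetilde h_i(x,y)\le0$, $\lambda_i\ge0$, $\lambda_i\widetilde h_i(x,y)=0$ for all $i$; $y$ is then a KKT point. SCSC holds at a KKT pair $(y,\lambda)$ if for every $i$ either $\widetilde h_i(x,y)<0$ and $\lambda_i=0$, or $\widetilde h_i(x,y)=0$ and $\lambda_i>0$. SCSC does not hold at the KKT point $y$ if it is violated at some KKT pair $(y,\lambda)$. The random vectors $a$ and $b$ are independent. *)

theory Defs
  imports "HOL-Probability.Probability"
begin

(* C^r on an open set: continuity for r = 0, and Frechet differentiability with all directional
   derivatives x |-> Df(x)v of class C^(r-1) otherwise.  Only meaningful for open S. *)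
primrec Cr_on :: "nat \<Rightarrow> 'a::euclidean_space set \<Rightarrow> ('a \<Rightarrow> real) \<Rightarrow> bool" where
  "Cr_on 0 S f \<longleftrightarrow> continuous_on S f"
| "Cr_on (Suc r) S f \<longleftrightarrow>
     (\<forall>x\<in>S. f differentiable (at x)) \<and>
     (\<forall>v. Cr_on r S (\<lambda>x. frechet_derivative f (at x) v))"

definition smooth_on :: "'a::euclidean_space set \<Rightarrow> ('a \<Rightarrow> real) \<Rightarrow> bool" where
  "smooth_on S f \<longleftrightarrow> open S \<and> (\<forall>r. Cr_on r S f)"

(* Underspecified where f is not differentiable. *)
definition gradient :: "('a::euclidean_space \<Rightarrow> real) \<Rightarrow> 'a \<Rightarrow> 'a" where
  "gradient f y = (THE D. GDERIV f y :> D)"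

definition feasible_set :: "('k \<Rightarrow> 'b \<Rightarrow> real) \<Rightarrow> 'b set" where
  "feasible_set c = {y. \<forall>i. c i y \<le> 0}"

(* The next four definitions concern the problem: minimise f y subject to c i y <= 0 for all i. *)
definition kkt_pair ::
  "('b::euclidean_space \<Rightarrow> real) \<Rightarrow> ('k::finite \<Rightarrow> 'b \<Rightarrow> real) \<Rightarrow> 'b \<Rightarrow> real^'k \<Rightarrow> bool" where
  "kkt_pair f c y l \<longleftrightarrow>
     gradient f y + (\<Sum>i\<in>UNIV. l $ i *\<^sub>R gradient (c i) y) = 0 \<and>
     (\<forall>i. c i y \<le> 0 \<and> 0 \<le> l $ i \<and> l $ i * c i y = 0)"

definition kkt_point ::
  "('b::euclidean_space \<Rightarrow> real) \<Rightarrow> ('k::finite \<Rightarrow> 'b \<Rightarrow> real) \<Rightarrow> 'b \<Rightarrow> bool" where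
  "kkt_point f c y \<longleftrightarrow> (\<exists>l. kkt_pair f c y l)"

definition scsc_at_pair :: "('k::finite \<Rightarrow> 'b \<Rightarrow> real) \<Rightarrow> 'b \<Rightarrow> real^'k \<Rightarrow> bool" where
  "scsc_at_pair c y l \<longleftrightarrow> (\<forall>i. (c i y < 0 \<and> l $ i = 0) \<or> (c i y = 0 \<and> 0 < l $ i))"

(* SCSC holds at a point when it holds at every KKT pair over that point;
   so it fails as soon as one multiplier violates it. *)
definition scsc_at_point ::
  "('b::euclidean_space \<Rightarrow> real) \<Rightarrow> ('k::finite \<Rightarrow> 'b \<Rightarrow> real) \<Rightarrow> 'b \<Rightarrow> bool" where
  "scsc_at_point f c y \<longleftrightarrow> (\<forall>l. kkt_pair f c y l \<longrightarrow> scsc_at_pair c y l)"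

definition perturbed_obj :: "('a \<times> 'b::euclidean_space \<Rightarrow> real) \<Rightarrow> 'b \<Rightarrow> 'a \<Rightarrow> 'b \<Rightarrow> real" where
  "perturbed_obj g b x y = g (x, y) + y \<bullet> b"

definition perturbed_con ::
  "('k::finite \<Rightarrow> 'a \<times> 'b \<Rightarrow> real) \<Rightarrow> real^'k \<Rightarrow> 'a \<Rightarrow> 'k \<Rightarrow> 'b \<Rightarrow> real" where
  "perturbed_con h a x i y = h i (x, y) + a $ i"

definition uniform_on_cube :: "'w measure \<Rightarrow> real \<Rightarrow> ('w \<Rightarrow> real^'d) \<Rightarrow> bool" where
  "uniform_on_cube M \<nu> X \<longleftrightarrow>
     X \<in> borel_measurable M \<and>
     distr M borel X = uniform_measure lborel (cbox 0 (\<chi> i. \<nu>))"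

(* prob_space.indep_var forces both variables to have the same codomain type,
   hence independence is stated here via the generated sigma-algebras. *)
definition independent_rvs ::
  "'w measure \<Rightarrow> ('w \<Rightarrow> 'b::topological_space) \<Rightarrow> ('w \<Rightarrow> 'c::topological_space) \<Rightarrow> bool" where
  "independent_rvs M X Y \<longleftrightarrow>
     prob_space.indep_set M
       (sets (vimage_algebra (space M) X borel)) (sets (vimage_algebra (space M) Y borel))"

end

theory Submission
  imports Defs
begin

text \<open>
  Suppose complementarity is not strict at some KKT pair \<open>(y, l)\<close> over \<open>x\<close>: some constraint \<open>i\<close> is
  active with \<open>l\<^sub>i = 0\<close>.  Let \<open>J\<close> be the support of \<open>l\<close>.  Stationarity determines \<open>b\<close> from \<open>x\<close>, \<open>y\<close>
  and \<open>(l\<^sub>j)\<close> for \<open>j \<in> J\<close>, while \<open>a\<^sub>j = - h\<^sub>j (x, y)\<close> for \<open>j \<in> J \<union> {i}\<close>.  So \<open>(b, a, x)\<close> is a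
  differentiable function of \<open>x\<close>, \<open>y\<close>, \<open>(l\<^sub>j)\<close> for \<open>j \<in> J\<close> and \<open>(a\<^sub>j)\<close> for \<open>j \<notin> J \<union> {i}\<close>, which is one
  parameter less than the dimension of \<open>(b, a, x)\<close>.  Hence all such triples form a
  null set, and Fubini's theorem yields the claim.
\<close>

section \<open>Gradients of the perturbed functions and failure of strict complementarity\<close>

definition partial_gradient ::
  "('a::euclidean_space \<times> 'b::euclidean_space \<Rightarrow> real) \<Rightarrow> 'a \<times> 'b \<Rightarrow> 'b" where
  "partial_gradient f p = (\<Sum>e\<in>Basis. frechet_derivative f (at p) (0, e) *\<^sub>R e)"

lemma gradient_eqI:
  assumes "GDERIV f y :> D"
  shows "gradient f y = D"
  unfolding gradient_def
proof (rule the_equality[where P = "\<lambda>D. GDERIV f y :> D"])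
  fix D' assume "GDERIV f y :> D'"
  with assms have "(\<lambda>v. v \<bullet> D') = (\<lambda>v. v \<bullet> D)"
    unfolding gderiv_def by (rule has_derivative_unique[rotated])
  then show "D' = D"
    by (metis euclidean_eqI inner_commute)
qed (fact assms)

text \<open>The chain rule along the embedding of \<open>y\<close> as \<open>(x, y)\<close> gives
  the derivative; expanding its argument in the basis turns this linear form into an inner
  product.\<close>

lemma GDERIV_partial_gradient:
  fixes f :: "'a::euclidean_space \<times> 'b::euclidean_space \<Rightarrow> real"
  assumes "f differentiable (at (x, y))"
  shows "GDERIV (\<lambda>y. f (x, y)) y :> partial_gradient f (x, y)"
proof -
  let ?D = "frechet_derivative f (at (x, y))"
  have D: "(f has_derivative ?D) (at (x, y))"
    using assms frechet_derivative_works by blast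
  have "((\<lambda>y. (x, y)) has_derivative (\<lambda>v. (0, v))) (at y)"
    by (auto intro!: derivative_eq_intros)
  then have "((\<lambda>y. f (x, y)) has_derivative (\<lambda>v. ?D (0, v))) (at y)"
    by (rule has_derivative_compose[where g = f]) (rule D)
  moreover have "?D (0, v) = v \<bullet> partial_gradient f (x, y)" for v
  proof -
    have lin: "linear (\<lambda>v. ?D (0, v))"
      using calculation has_derivative_linear by blast
    have "?D (0, v) = ?D (0, \<Sum>e\<in>Basis. (v \<bullet> e) *\<^sub>R e)"
      by (simp add: euclidean_representation)
    also have "\<dots> = (\<Sum>e\<in>Basis. (v \<bullet> e) * ?D (0, e))"
      by (simp add: linear_sum[OF lin] linear_scale[OF lin])
    also have "\<dots> = v \<bullet> partial_gradient f (x, y)"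
      by (simp add: partial_gradient_def inner_sum_right mult.commute)
    finally show ?thesis .
  qed
  ultimately show ?thesis
    by (simp add: gderiv_def)
qed

lemma smooth_on_imp_differentiable:
  assumes "smooth_on U f" "p \<in> U"
  shows "f differentiable (at p)"
  using assms unfolding smooth_on_def by (metis Cr_on.simps(2))

text \<open>Two orders of smoothness suffice. Differentiability is joint in \<open>x\<close> and
  \<open>y\<close>, because \<open>x\<close> is itself one of the parameters varied below.\<close>

lemma smooth_on_partial_gradient_differentiable:
  assumes "smooth_on U f" "p \<in> U"
  shows "partial_gradient f differentiable (at p)"
proof -
  have "Cr_on (Suc (Suc 0)) U f"
    using assms unfolding smooth_on_def by blast
  then have "(\<lambda>q. frechet_derivative f (at q) v) differentiable (at p)" for v
    using assms(2) by (simp del: split_paired_All)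
  then show ?thesis
    unfolding partial_gradient_def by (intro differentiable_sum) (auto intro!: differentiable_scaleR)
qed

lemma gradient_perturbed_obj:
  assumes "g differentiable (at (x, y))"
  shows "gradient (perturbed_obj g b x) y = partial_gradient g (x, y) + b"
proof (rule gradient_eqI)
  have "GDERIV (\<lambda>y. y \<bullet> b) y :> b"
    unfolding gderiv_def by (auto intro!: derivative_eq_intros)
  then show "GDERIV (perturbed_obj g b x) y :> partial_gradient g (x, y) + b"
    using GDERIV_add[OF GDERIV_partial_gradient[OF assms]]
    by (simp add: perturbed_obj_def[abs_def])
qed

lemma gradient_perturbed_con:
  assumes "h i differentiable (at (x, y))"
  shows "gradient (perturbed_con h a x i) y = partial_gradient (h i) (x, y)"
proof (rule gradient_eqI)
  show "GDERIV (perturbed_con h a x i) y :> partial_gradient (h i) (x, y)"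
    using GDERIV_add[OF GDERIV_partial_gradient[OF assms] GDERIV_const[of "a $ i"]]
    by (simp add: perturbed_con_def[abs_def])
qed

text \<open>Complementarity makes one of the two factors vanish; if the other were nonzero, its sign
  would give one of the strict alternatives.\<close>

lemma kkt_pair_not_scscE:
  assumes "kkt_pair f c y l" "\<not> scsc_at_pair c y l"
  obtains i where "c i y = 0" "l $ i = 0"
proof -
  obtain i where i: "\<not> (c i y < 0 \<and> l $ i = 0)" "\<not> (c i y = 0 \<and> 0 < l $ i)"
    using assms(2) unfolding scsc_at_pair_def by blast
  moreover have "c i y \<le> 0" "0 \<le> l $ i" "l $ i * c i y = 0"
    using assms(1) unfolding kkt_pair_def by blast+
  ultimately have "c i y = 0" "l $ i = 0"
    by auto
  then show thesis
    by (rule that)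
qed

section \<open>Parametrisation of the exceptional triples, and their negligibility\<close>

text \<open>The coordinate \<open>t\<^sub>i\<close> stands for the multiplier \<open>l\<^sub>i\<close> if \<open>i \<in> J\<close>, and for \<open>a\<^sub>i\<close> otherwise.\<close>

definition kkt_perturbation ::
  "('a::euclidean_space \<times> 'b::euclidean_space \<Rightarrow> real) \<Rightarrow> ('k::finite \<Rightarrow> 'a \<times> 'b \<Rightarrow> real) \<Rightarrow>
    'k set \<Rightarrow> 'k \<Rightarrow> ('a \<times> 'b) \<times> (real^'k) \<Rightarrow> ('b \<times> (real^'k)) \<times> 'a" where
  "kkt_perturbation g h J i = (\<lambda>(p, t).
     ((- partial_gradient g p - (\<Sum>j\<in>J. t $ j *\<^sub>R partial_gradient (h j) p),
       \<Sum>j\<in>UNIV. (if j \<in> insert i J then - h j p else t $ j) *\<^sub>R axis j 1),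
      fst p))"

lemma differentiable_Pair:
  assumes "f differentiable (at x within S)" "g differentiable (at x within S)"
  shows "(\<lambda>x. (f x, g x)) differentiable (at x within S)"
  using assms unfolding differentiable_def by (blast intro: has_derivative_Pair)

lemma differentiable_compose_fst:
  assumes "f differentiable (at (fst q))"
  shows "(\<lambda>q. f (fst q)) differentiable (at q)"
proof -
  have "fst differentiable (at q)"
    by (intro bounded_linear_imp_differentiable bounded_linear_fst)
  then show ?thesis
    using differentiable_chain_at[of fst q f] assms by (simp add: o_def)
qed

lemma kkt_perturbation_differentiable_on:
  fixes g :: "'a::euclidean_space \<times> 'b::euclidean_space \<Rightarrow> real"
    and h :: "'k::finite \<Rightarrow> 'a \<times> 'b \<Rightarrow> real"
  assumes g: "smooth_on U g" and h: "\<And>i. smooth_on U (h i)"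
  shows "kkt_perturbation g h J i differentiable_on (U \<times> UNIV)"
proof (rule differentiable_at_imp_differentiable_on)
  fix q :: "('a \<times> 'b) \<times> (real^'k)"
  assume "q \<in> U \<times> UNIV"
  then have q: "fst q \<in> U" by auto
  have snd: "(\<lambda>q. snd q $ j) differentiable (at q)" for j
    by (intro bounded_linear_imp_differentiable bounded_linear_compose[OF bounded_linear_vec_nth]
        bounded_linear_snd)
  have ffst: "(\<lambda>q. fst (fst q)) differentiable (at q)"
    by (intro bounded_linear_imp_differentiable bounded_linear_compose[OF bounded_linear_fst]
        bounded_linear_fst)
  note smooth = differentiable_compose_fst[OF smooth_on_imp_differentiable[OF h q]]
    differentiable_compose_fst[OF smooth_on_partial_gradient_differentiable[OF g q]]
    differentiable_compose_fst[OF smooth_on_partial_gradient_differentiable[OF h q]]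
  \<comment> \<open>The case distinction depends on \<open>j\<close> alone, so for each
    \<open>j\<close> a single branch applies at every \<open>q\<close>.\<close>
  have "(\<lambda>q. if j \<in> insert i J then - h j (fst q) else snd q $ j) differentiable (at q)" for j
    by (cases "j \<in> insert i J") (simp_all add: smooth snd)
  then show "kkt_perturbation g h J i differentiable (at q)"
    unfolding kkt_perturbation_def case_prod_unfold
    by (intro differentiable_Pair differentiable_diff differentiable_minus differentiable_sum ballI
        differentiable_scaleR smooth snd ffst) auto
qed

text \<open>The KKT equations are solved for the perturbation: stationarity for \<open>b\<close>,
  the active constraints for the corresponding entries of \<open>a\<close>. The condition
  \<open>t $ i = 0\<close> records the lost dimension.\<close>

lemma kkt_pair_in_kkt_perturbation_image:
  fixes g :: "'a::euclidean_space \<times> 'b::euclidean_space \<Rightarrow> real"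
    and h :: "'k::finite \<Rightarrow> 'a \<times> 'b \<Rightarrow> real"
  assumes g: "smooth_on U g" and h: "\<And>i. smooth_on U (h i)" and U: "(x, y) \<in> U"
    and kkt: "kkt_pair (perturbed_obj g b x) (perturbed_con h a x) y l"
    and i: "perturbed_con h a x i y = 0" "l $ i = 0"
  shows "((b, a), x) \<in> kkt_perturbation g h {j. l $ j \<noteq> 0} i ` (U \<times> {t. t $ i = 0})"
proof -
  define J where "J = {j. l $ j \<noteq> 0}"
  \<comment> \<open>Coordinate \<open>i\<close> is free to be set to 0: \<open>l $ i = 0\<close>
    keeps \<open>i\<close> out of \<open>J\<close>, and entry \<open>i\<close> of \<open>a\<close>
    is recovered from \<open>h i\<close>.\<close>
  define t where "t = (\<chi> j. if j = i then 0 else if j \<in> J then l $ j else a $ j)"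
  have "partial_gradient g (x, y) + b
      + (\<Sum>j\<in>UNIV. l $ j *\<^sub>R partial_gradient (h j) (x, y)) = 0"
    using kkt unfolding kkt_pair_def
    by (simp add: gradient_perturbed_obj gradient_perturbed_con
        smooth_on_imp_differentiable[OF g U] smooth_on_imp_differentiable[OF h U])
  moreover have "(\<Sum>j\<in>UNIV. l $ j *\<^sub>R partial_gradient (h j) (x, y))
      = (\<Sum>j\<in>J. t $ j *\<^sub>R partial_gradient (h j) (x, y))"
    using i(2) by (intro sum.mono_neutral_cong_right) (auto simp: t_def J_def)
  ultimately have b: "b = - partial_gradient g (x, y)
      - (\<Sum>j\<in>J. t $ j *\<^sub>R partial_gradient (h j) (x, y))"
    by (simp add: algebra_simps add_eq_0_iff2)
  \<comment> \<open>For \<open>j\<close> in \<open>J\<close> the multiplier is nonzero, so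
    complementary slackness makes the constraint active; for \<open>i\<close> this is
    assumed.\<close>
  have "perturbed_con h a x j y = 0" if "j \<in> insert i J" for j
    using kkt i(1) that unfolding kkt_pair_def J_def by auto
  then have "a $ j = (if j \<in> insert i J then - h j (x, y) else t $ j)" for j
    by (auto simp: perturbed_con_def t_def add_eq_0_iff2)
  then have "a = (\<Sum>j\<in>UNIV. (if j \<in> insert i J then - h j (x, y) else t $ j) *\<^sub>R axis j 1)"
    using basis_expansion[of a] by (simp add: scalar_mult_eq_scaleR)
  with b have "((b, a), x) = kkt_perturbation g h J i ((x, y), t)"
    by (simp add: kkt_perturbation_def)
  moreover have "t $ i = 0"
    by (simp add: t_def)
  ultimately show ?thesis
    using U unfolding J_def by blast
qed

text \<open>There are only finitely many pairs \<open>(J, i)\<close>, and each contributes the image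
  of a hyperplane piece under a differentiable map.\<close>

lemma negligible_not_scsc:
  fixes g :: "'a::euclidean_space \<times> 'b::euclidean_space \<Rightarrow> real"
    and h :: "'k::finite \<Rightarrow> 'a \<times> 'b \<Rightarrow> real"
  assumes g: "smooth_on U g" and h: "\<And>i. smooth_on U (h i)"
  shows "negligible {((b, a), x). \<exists>y. (x, y) \<in> U \<and>
    \<not> scsc_at_point (perturbed_obj g b x) (perturbed_con h a x) y}" (is "negligible ?B")
proof -
  let ?H = "\<lambda>i. U \<times> {t :: real^'k. t $ i = 0}"
  \<comment> \<open>Parameter space and target have the same dimension, so a differentiable map
    sends null sets to null sets; the hyperplane \<open>t $ i = 0\<close> is null.\<close>
  have "negligible (kkt_perturbation g h J i ` ?H i)" for J i
  proof (rule negligible_differentiable_image_negligible)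
    have "negligible {q :: ('a \<times> 'b) \<times> (real^'k). (0, axis i 1) \<bullet> q = 0}"
      by (rule negligible_hyperplane) (simp add: zero_prod_def)
    moreover have "?H i \<subseteq> {q. (0, axis i 1) \<bullet> q = 0}"
      by (clarsimp simp only: mem_Collect_eq inner_Pair inner_axis' inner_zero_left) simp
    ultimately show "negligible (?H i)"
      by (rule negligible_subset)
    show "kkt_perturbation g h J i differentiable_on ?H i"
      by (rule differentiable_on_subset[OF kkt_perturbation_differentiable_on[OF g h]]) auto
  qed simp
  then have "negligible (\<Union>(J, i)\<in>UNIV. kkt_perturbation g h J i ` ?H i)"
    by (intro negligible_Union) auto
  moreover have "?B \<subseteq> (\<Union>(J, i)\<in>UNIV. kkt_perturbation g h J i ` ?H i)"
  proof (rule subsetI)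
    fix z
    assume "z \<in> ?B"
    then obtain b a x y where z: "z = ((b, a), x)" and U: "(x, y) \<in> U"
      and "\<not> scsc_at_point (perturbed_obj g b x) (perturbed_con h a x) y"
      by blast
    then obtain l where kkt: "kkt_pair (perturbed_obj g b x) (perturbed_con h a x) y l"
      "\<not> scsc_at_pair (perturbed_con h a x) y l"
      unfolding scsc_at_point_def by blast
    then obtain i where "perturbed_con h a x i y = 0" "l $ i = 0"
      by (rule kkt_pair_not_scscE)
    then have "z \<in> kkt_perturbation g h {j. l $ j \<noteq> 0} i ` ?H i"
      unfolding z by (rule kkt_pair_in_kkt_perturbation_image[OF g h U kkt(1)])
    then show "z \<in> (\<Union>(J, i)\<in>UNIV. kkt_perturbation g h J i ` ?H i)"
      by blast
  qed
  ultimately show ?thesis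
    by (rule negligible_subset)
qed

section \<open>The joint law of independent uniform perturbations\<close>

lemma distr_Pair_independent_rvs:
  assumes M: "prob_space M"
    and X: "X \<in> borel_measurable M" and Y: "Y \<in> borel_measurable M"
    and indep: "independent_rvs M X Y"
  shows "distr M borel X \<Otimes>\<^sub>M distr M borel Y = distr M (borel \<Otimes>\<^sub>M borel) (\<lambda>\<omega>. (X \<omega>, Y \<omega>))"
proof (rule pair_measure_eqI)
  interpret prob_space M by fact
  have XY: "(\<lambda>\<omega>. (X \<omega>, Y \<omega>)) \<in> measurable M (borel \<Otimes>\<^sub>M borel)"
    using X Y by measurable
  interpret X: prob_space "distr M borel X" by (rule prob_space_distr) fact
  interpret Y: prob_space "distr M borel Y" by (rule prob_space_distr) fact
  show "sigma_finite_measure (distr M borel X)" "sigma_finite_measure (distr M borel Y)"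
    by unfold_locales
  show "sets (distr M borel X \<Otimes>\<^sub>M distr M borel Y)
      = sets (distr M (borel \<Otimes>\<^sub>M borel) (\<lambda>\<omega>. (X \<omega>, Y \<omega>)))"
    by (simp cong: sets_pair_measure_cong)
  fix A B
  assume "A \<in> sets (distr M borel X)" "B \<in> sets (distr M borel Y)"
  then have AB: "A \<in> sets borel" "B \<in> sets borel" by auto
  \<comment> \<open>On rectangles the product formula is independence, and values on rectangles
    determine a product of sigma-finite measures.\<close>
  have "prob ((X -` A \<inter> space M) \<inter> (Y -` B \<inter> space M))
      = prob (X -` A \<inter> space M) * prob (Y -` B \<inter> space M)"
    using indep AB unfolding independent_rvs_def by (intro indep_setD) (auto intro: in_vimage_algebra)
  moreover have "(X -` A \<inter> space M) \<inter> (Y -` B \<inter> space M)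
      = (\<lambda>\<omega>. (X \<omega>, Y \<omega>)) -` (A \<times> B) \<inter> space M"
    by auto
  ultimately show "emeasure (distr M borel X) A * emeasure (distr M borel Y) B
      = emeasure (distr M (borel \<Otimes>\<^sub>M borel) (\<lambda>\<omega>. (X \<omega>, Y \<omega>))) (A \<times> B)"
    using AB X Y XY by (simp add: emeasure_distr emeasure_eq_measure ennreal_mult)
qed

text \<open>The law is normalised Lebesgue measure on the cube, hence absolutely continuous.\<close>

lemma AE_uniform_on_cube:
  assumes "uniform_on_cube M \<nu> X" and "AE x in lborel. P x"
  shows "AE x in distr M borel X. P x"
proof -
  have "distr M borel X = uniform_measure lborel (cbox 0 (\<chi> i. \<nu>))"
    using assms(1) unfolding uniform_on_cube_def by blast
  then show ?thesis
    using assms(2) by (simp only:) (rule AE_uniform_measureI; auto)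
qed

text \<open>Absolute continuity of each factor passes to the joint law by slicing: Lebesgue measure
  is replaced by the cube law first in the inner variable, then in the outer one. Measurability of
  \<open>Z\<close> allows the return from slices to the product.\<close>

lemma AE_independent_uniform_on_cube:
  fixes X :: "'w \<Rightarrow> real^'m" and Y :: "'w \<Rightarrow> real^'k"
  assumes M: "prob_space M"
    and X: "uniform_on_cube M \<nu> X" and Y: "uniform_on_cube M \<mu> Y"
    and indep: "independent_rvs M X Y"
    and Z: "Z \<in> sets borel" and AE: "AE p in lborel. p \<in> Z"
  shows "AE \<omega> in M. (X \<omega>, Y \<omega>) \<in> Z"
proof -
  interpret prob_space M by fact
  have XY: "X \<in> borel_measurable M" "Y \<in> borel_measurable M"
    using X Y unfolding uniform_on_cube_def by auto
  interpret X: prob_space "distr M borel X" by (rule prob_space_distr) fact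
  interpret Y: prob_space "distr M borel Y" by (rule prob_space_distr) fact
  interpret XY: pair_sigma_finite "distr M borel X" "distr M borel Y" ..
  have "AE p in lborel \<Otimes>\<^sub>M lborel. p \<in> Z"
    unfolding lborel_prod by (rule AE)
  then have "AE u in lborel. AE v in lborel. (u, v) \<in> Z"
    by (rule lborel_pair.AE_pair)
  then have "AE u in lborel. AE v in distr M borel Y. (u, v) \<in> Z"
    by (rule AE_mp) (use AE_uniform_on_cube[OF Y] in auto)
  then have AE': "AE u in distr M borel X. AE v in distr M borel Y. (u, v) \<in> Z"
    by (rule AE_uniform_on_cube[OF X])
  have "AE p in distr M borel X \<Otimes>\<^sub>M distr M borel Y. p \<in> Z"
  proof (rule XY.AE_pair_measure[OF _ AE'])
    have "sets (distr M borel X \<Otimes>\<^sub>M distr M borel Y) = sets borel"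
      by (metis borel_prod sets_distr sets_pair_measure_cong)
    moreover have "space (distr M borel X \<Otimes>\<^sub>M distr M borel Y) = UNIV"
      by (simp add: space_pair_measure)
    ultimately show "{p \<in> space (distr M borel X \<Otimes>\<^sub>M distr M borel Y). p \<in> Z}
        \<in> sets (distr M borel X \<Otimes>\<^sub>M distr M borel Y)"
      using Z by (simp only: UNIV_I simp_thms Collect_mem_eq)
  qed
  then have "AE p in distr M borel (\<lambda>\<omega>. (X \<omega>, Y \<omega>)). p \<in> Z"
    unfolding distr_Pair_independent_rvs[OF M XY indep] borel_prod .
  then show ?thesis
    using Z XY by (subst (asm) AE_distr_iff) auto
qed

section \<open>Fubini's theorem and the conclusion\<close>

theorem theorem3p2:
  fixes X :: "(real^'n) set"
    and g :: "(real^'n) \<times> (real^'m) \<Rightarrow> real"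
    and h :: "'k::finite \<Rightarrow> (real^'n) \<times> (real^'m) \<Rightarrow> real"
    and \<rho> \<nu> :: real
    and M :: "'w measure"
    and b :: "'w \<Rightarrow> real^'m"
    and a :: "'w \<Rightarrow> real^'k"
  assumes "X \<in> sets lebesgue"
    and "\<exists>U. open U \<and> X \<times> UNIV \<subseteq> U \<and> smooth_on U g \<and> (\<forall>i. smooth_on U (h i))"
    and "\<rho> > 0"
    and "\<forall>x\<in>X. \<exists>y \<in> interior (feasible_set (\<lambda>i y. h i (x, y))). \<forall>i. h i (x, y) \<le> -\<rho>"
    and "0 < \<nu>" and "\<nu> < \<rho>"
    and "prob_space M"
    and "uniform_on_cube M \<nu> b" and "uniform_on_cube M \<nu> a"
    and "independent_rvs M b a"
  shows "AE \<omega> in M.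
    {x \<in> X. \<exists>y. kkt_point (perturbed_obj g (b \<omega>) x) (perturbed_con h (a \<omega>) x) y \<and>
                \<not> scsc_at_point (perturbed_obj g (b \<omega>) x) (perturbed_con h (a \<omega>) x) y}
      \<in> null_sets lebesgue"
proof -
  obtain U where U: "X \<times> UNIV \<subseteq> U" and g: "smooth_on U g" and h: "\<And>i. smooth_on U (h i)"
    using assms(2) by blast
  define B where "B = {((b, a), x). \<exists>y. (x, y) \<in> U \<and>
    \<not> scsc_at_point (perturbed_obj g b x) (perturbed_con h a x) y}"
  have "B \<in> null_sets lebesgue"
    using negligible_not_scsc[OF g h] unfolding B_def negligible_iff_null_sets .
  \<comment> \<open>\<open>B\<close> is only known to be Lebesgue null; a Borel null superset makes
    the slices and the slice measure Borel measurable.\<close>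
  then obtain N where N: "N \<in> null_sets lborel" "B \<subseteq> N"
    unfolding null_sets_completion_iff2 by blast
  \<comment> \<open>The good perturbations \<open>(b, a)\<close>: those whose slice of
    \<open>N\<close> in the \<open>x\<close> direction is null.\<close>
  define Z where "Z = {p. emeasure lborel (Pair p -` N) = 0}"
  have N': "N \<in> sets (lborel \<Otimes>\<^sub>M lborel)"
    using null_setsD2[OF N(1)] unfolding lborel_prod .
  have slice: "Pair p -` N \<in> sets lborel" for p
    using N' by (rule sets_Pair1)
  have "(\<lambda>p. emeasure lborel (Pair p -` N)) \<in> borel_measurable lborel"
    using N' by (rule lborel.measurable_emeasure_Pair)
  then have Z: "Z \<in> sets borel"
    unfolding Z_def by measurable
  have "AE q in lborel. q \<notin> N"
    using N(1) by (rule AE_not_in)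
  then have "AE p in lborel. AE x in lborel. (p, x) \<notin> N"
    unfolding lborel_prod[symmetric, where 'a = "(real^'m) \<times> (real^'k)"] by (rule lborel_pair.AE_pair)
  moreover have "p \<in> Z" if "AE x in lborel. (p, x) \<notin> N" for p
    using that AE_iff_measurable[OF slice, of "\<lambda>x. (p, x) \<notin> N" p] by (simp add: Z_def vimage_def)
  ultimately have "AE p in lborel. p \<in> Z"
    by auto
  then have "AE \<omega> in M. (b \<omega>, a \<omega>) \<in> Z"
    by (rule AE_independent_uniform_on_cube[OF assms(7-10) Z])
  then show ?thesis
  proof (rule AE_mp, intro AE_I2 impI)
    fix \<omega>
    assume "(b \<omega>, a \<omega>) \<in> Z"
    with slice have "Pair (b \<omega>, a \<omega>) -` N \<in> null_sets lborel"
      by (auto simp: Z_def)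
    \<comment> \<open>Points over \<open>X\<close> lie in \<open>U\<close>, so each bad
      \<open>x\<close> puts its triple in \<open>B\<close> and hence in \<open>N\<close>. A subset
      of a Borel null set is Lebesgue null, which also settles its measurability.\<close>
    moreover have "{x \<in> X. \<exists>y. kkt_point (perturbed_obj g (b \<omega>) x) (perturbed_con h (a \<omega>) x) y \<and>
        \<not> scsc_at_point (perturbed_obj g (b \<omega>) x) (perturbed_con h (a \<omega>) x) y}
      \<subseteq> Pair (b \<omega>, a \<omega>) -` N"
      using U N(2) unfolding B_def by blast
    ultimately show "{x \<in> X. \<exists>y. kkt_point (perturbed_obj g (b \<omega>) x) (perturbed_con h (a \<omega>) x) y \<and>
        \<not> scsc_at_point (perturbed_obj g (b \<omega>) x) (perturbed_con h (a \<omega>) x) y} \<in> null_sets lebesgue"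
      unfolding null_sets_completion_iff2 by blast
  qed
qed

end
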